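(* Let $q$ be a prime power and $h\ge 2$ an integer. Let $S\subseteq\mathrm{AG}(2,q)$ be a point set such that $S\cup\{(\infty)\}$ is regular of affine type $(m_1,\ldots,m_g)$ in $\mathrm{PG}(2,q)$. Let $I$ be an $(h-1)$-dimensional $\mathrm{GF}(q)$-subspace of $\mathrm{GF}(q^h)$ with $I\cap\mathrm{GF}(q)=\{0\}$, and let $$S'=\{(x,y+i) : i\in I,\ (x,y)\in S\}\subseteq\mathrm{AG}(2,q^h).$$ Then $S'\cup\{(\infty)\}$ is regular of affine type $(m_1,\ldots,m_g)$ in $\mathrm{PG}(2,q^h)$. Moreover, the number of non-vertical affine $k$-secants of $S'$ is a multiple of $q^{2h-1}$ for every integer $k$.
   Context: For a prime power $Q$, $\mathrm{AG}(2,Q)$ is $\mathrm{PG}(2,Q)$ minus the line at infinity $\ell_\infty$; affine points are written $(x,y)$. Vertical lines are the affine lines of equation $x=\alpha$; $(\infty)\in\ell_\infty$ is their common ideal point. A line is a $k$-secant of a point set if it meets it in exactly $k$ points. A point set $X$ of $\mathrm{PG}(2,Q)$ is regular of affine type $(m_1,\ldots,m_g)$ if there are a distinguished point $P_0\in X$ and a line $\ell_0$ with $\ell_0\cap X=\{P_0\}$ such that: (i) every line not through $P_0$ is an $m_i$-secant of $X$ for some $i$; (ii) for each $i$, the number of $m_i$-secants of $X$ incident with $P$ is the same for each $P\in\ell_0\setminus\{P_0\}$. (It is not required that each $m_i$ occurs.) Throughout, the distinguished point is always $P_0=(\infty)$ and the tangent is $\ell_0=\ell_\infty$, both for $S\cup\{(\infty)\}$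 and for $S'\cup\{(\infty)\}$. *)

theory Defs
  imports "HOL-Analysis.Analysis" "HOL-Number_Theory.Prime_Powers"
begin

text \<open>
  The projective plane over a field: points are the 1-dimensional subspaces of the
  coordinate space of dimension 3, and a line is the set of all points contained in a
  given 2-dimensional subspace.
\<close>

type_synonym 'a pg_point = "('a ^ 3) set"

definition pg_points :: "('a::field) pg_point set" where
  "pg_points = {P. vec.subspace P \<and> vec.dim P = 1}"

definition pg_lines :: "('a::field) pg_point set set" where
  "pg_lines = {{P \<in> pg_points. P \<subseteq> W} | W. vec.subspace W \<and> vec.dim W = 2}"

text \<open>
  Affine coordinates: (x,y) has homogeneous coordinates (x,y,1), the line at infinity is
  the line on which the third coordinate vanishes, and the common ideal point of the
  vertical lines has homogeneous coordinates (0,1,0).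
\<close>

definition affine_point :: "'a \<times> 'a \<Rightarrow> ('a::field) pg_point" where
  "affine_point p = vec.span {vector [fst p, snd p, 1]}"

definition line_inf :: "('a::field) pg_point set" where
  "line_inf = {P \<in> pg_points. \<forall>v\<in>P. v $ 3 = 0}"

definition point_inf :: "('a::field) pg_point" where
  "point_inf = vec.span {vector [0, 1, 0]}"

definition affine_lines :: "('a::field) pg_point set set" where
  "affine_lines = pg_lines - {line_inf}"

text \<open>The line x = \<open>\<alpha>\<close>, including its ideal point.\<close>

definition vertical_line :: "'a \<Rightarrow> ('a::field) pg_point set" where
  "vertical_line \<alpha> = insert point_inf {affine_point (\<alpha>, y) | y. True}"

definition is_secant :: "int \<Rightarrow> ('a::field) pg_point set \<Rightarrow> 'a pg_point set \<Rightarrow> bool" where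
  "is_secant k X l \<longleftrightarrow> l \<in> pg_lines \<and> finite (l \<inter> X) \<and> int (card (l \<inter> X)) = k"

text \<open>
  In the second condition all lines through P are counted, including the tangent
  \<open>L\<^sub>0\<close> itself (which is a 1-secant).
\<close>

definition regular_affine_type ::
  "('a::field) pg_point \<Rightarrow> 'a pg_point set \<Rightarrow> int list \<Rightarrow> 'a pg_point set \<Rightarrow> bool" where
  "regular_affine_type P\<^sub>0 L\<^sub>0 ms X \<longleftrightarrow>
     X \<subseteq> pg_points \<and> P\<^sub>0 \<in> X \<and> L\<^sub>0 \<in> pg_lines \<and> L\<^sub>0 \<inter> X = {P\<^sub>0} \<and>
     (\<forall>l\<in>pg_lines. P\<^sub>0 \<notin> l \<longrightarrow> (\<exists>m\<in>set ms. is_secant m X l)) \<and>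
     (\<forall>m\<in>set ms. \<exists>c. \<forall>P\<in>L\<^sub>0 - {P\<^sub>0}. card {l. is_secant m X l \<and> P \<in> l} = c)"

text \<open>A field embedding, used to identify a field with a subfield of a larger one.\<close>

definition field_embedding :: "('a::field \<Rightarrow> 'b::field) \<Rightarrow> bool" where
  "field_embedding \<iota> \<longleftrightarrow> \<iota> 1 = 1 \<and>
     (\<forall>x y. \<iota> (x + y) = \<iota> x + \<iota> y) \<and> (\<forall>x y. \<iota> (x * y) = \<iota> x * \<iota> y)"

text \<open>
  Subspaces and dimension for the larger field viewed as a vector space over the smaller one;
  \<open>\<lambda>c v. \<iota> c * v\<close> is the scalar multiplication.
\<close>

abbreviation subspace_over :: "('a::field \<Rightarrow> 'b::field) \<Rightarrow> 'b set \<Rightarrow> bool" where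
  "subspace_over \<iota> \<equiv> module.subspace (\<lambda>c v. \<iota> c * v)"

abbreviation dim_over :: "('a::field \<Rightarrow> 'b::field) \<Rightarrow> 'b set \<Rightarrow> nat" where
  "dim_over \<iota> \<equiv> vector_space.dim (\<lambda>c v. \<iota> c * v)"

lemma vector_space_over:
  assumes "field_embedding \<iota>"
  shows "vector_space (\<lambda>c v. \<iota> c * v)"
  using assms by unfold_locales (simp_all add: field_embedding_def algebra_simps)

end

theory Submission
  imports Defs
begin

text \<open>
  Write \<open>F = GF(q)\<close> and \<open>K = GF(q^h)\<close>.  A line of the plane that misses \<open>(\<infinity>)\<close> is the graph
  of a map \<open>x \<mapsto> a x + b\<close>, with ideal point \<open>(1 : a : 0)\<close>.  Let \<open>n(a, b)\<close> be the number of
  points of \<open>S\<close> on it.  Since the tangent line at infinity adds the same summand for every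
  ideal point, regularity says exactly that all \<open>n(a, b)\<close> are among the \<open>m\<^sub>i\<close> and that, for
  each \<open>m\<^sub>i\<close>, the number of \<open>b\<close> with \<open>n(a, b) = m\<^sub>i\<close> does not depend on \<open>a\<close>
  (\<open>regular_affine_type_iff_graph_count\<close>).

  The dimension of \<open>I\<close> and \<open>I \<inter> F = {0}\<close> give \<open>K = F \<oplus> I\<close>, so the coefficients of a line over
  \<open>K\<close> are uniquely \<open>a + i\<close> and \<open>b + j\<close> with \<open>a, b \<in> F\<close> and \<open>i, j \<in> I\<close>.  A point
  \<open>(x, y + k)\<close> of \<open>S'\<close> lies on that line iff \<open>y + k = (a x + b) + (i x + j)\<close>.  As
  \<open>i x + j \<in> I\<close>, comparing the components in \<open>F\<close> and \<open>I\<close> turns this into \<open>y = a x + b\<close> and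
  \<open>k = i x + j\<close>.  So \<open>k\<close> is determined by \<open>x\<close>, and \<open>n'(a + i, b + j) = n(a, b)\<close>
  (\<open>graph_count_lift_set\<close>).

  Hence both sets have the same intersection numbers, and for a fixed slope over \<open>K\<close> each of
  them occurs \<open>|I| = q^(h - 1)\<close> times as often as for a slope over \<open>F\<close>
  (\<open>card_intercepts_lift_set\<close>).  This count is again independent of the slope, which gives
  regularity; summing it over the \<open>q^h\<close> slopes gives a multiple of
  \<open>q^h q^(h - 1) = q^(2 h - 1)\<close>.
\<close>

section \<open>Points and lines of the plane in affine coordinates\<close>

definition slope_point :: "'a \<Rightarrow> ('a::field) pg_point" where
  "slope_point a = vec.span {vector [1, a, 0]}"

definition graph_line :: "'a \<Rightarrow> 'a \<Rightarrow> ('a::field) pg_point set" where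
  "graph_line a b = insert (slope_point a) {affine_point (x, a * x + b) | x. True}"

lemma span_singleton_subset_iff:
  assumes "vec.subspace W"
  shows "vec.span {v} \<subseteq> W \<longleftrightarrow> v \<in> W"
  using assms vec.span_base vec.span_minimal[of "{v}" W] by blast

lemma span_singleton_eq_iff:
  fixes u v :: "'a::field ^ 'n"
  assumes "v \<noteq> 0"
  shows "vec.span {u} = vec.span {v} \<longleftrightarrow> (\<exists>c. c \<noteq> 0 \<and> u = c *s v)"
proof
  assume eq: "vec.span {u} = vec.span {v}"
  then have "u \<in> vec.span {v}" "v \<in> vec.span {u}"
    using vec.span_base by blast+
  then obtain c d where "u = c *s v" "v = d *s u"
    unfolding vec.span_singleton by blast
  then show "\<exists>c. c \<noteq> 0 \<and> u = c *s v"
    using assms by (intro exI[of _ c]) auto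
next
  assume "\<exists>c. c \<noteq> 0 \<and> u = c *s v"
  then obtain c where c: "c \<noteq> 0" "u = c *s v" by blast
  then have "v = inverse c *s u" by simp
  then have "v \<in> vec.span {u}" "u \<in> vec.span {v}"
    unfolding vec.span_singleton using c by blast+
  then show "vec.span {u} = vec.span {v}"
    by (simp add: subset_antisym span_singleton_subset_iff)
qed

lemma vector3_nonzero:
  "vector [x, y, z] = (0 :: 'a::zero ^ 3) \<longleftrightarrow> x = 0 \<and> y = 0 \<and> z = 0"
  by (simp add: vec_eq_iff forall_3)

text \<open>
  Points are sets of vectors, and general automation would try to prove or refute their
  equality elementwise.  These rules decide every equality between normalized points instead.
\<close>

lemma homogeneous_points_distinct:
  fixes a :: "'a::field"
  shows "affine_point p = affine_point p' \<longleftrightarrow> p = p'"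
    and "slope_point a = slope_point a' \<longleftrightarrow> a = a'"
    and "affine_point p \<noteq> slope_point a"
    and "slope_point a \<noteq> affine_point p"
    and "affine_point p \<noteq> point_inf"
    and "point_inf \<noteq> affine_point p"
    and "slope_point a \<noteq> point_inf"
    and "point_inf \<noteq> slope_point a"
  by (auto simp: affine_point_def slope_point_def point_inf_def span_singleton_eq_iff
      vector3_nonzero vec_eq_iff forall_3 prod_eq_iff)

lemma pg_points_iff: "P \<in> pg_points \<longleftrightarrow> (\<exists>v. v \<noteq> 0 \<and> P = vec.span {v})"
proof
  assume "P \<in> pg_points"
  then have P: "vec.subspace P" "vec.dim P = 1" by (auto simp: pg_points_def)
  obtain B where B: "B \<subseteq> P" "vec.independent B" "P \<subseteq> vec.span B" "card B = vec.dim P"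
    using vec.basis_exists by blast
  then obtain v where v: "B = {v}" using P by (auto simp: card_1_singleton_iff)
  then have "v \<noteq> 0" using B(2) by auto
  moreover have "P = vec.span {v}"
    using B v P(1) by (simp add: span_singleton_subset_iff subset_antisym)
  ultimately show "\<exists>v. v \<noteq> 0 \<and> P = vec.span {v}" by blast
next
  assume "\<exists>v. v \<noteq> 0 \<and> P = vec.span {v}"
  then obtain v where v: "v \<noteq> 0" "P = vec.span {v}" by blast
  then have "vec.dim P = card {v}"
    by (simp only: vec.dim_span) (rule vec.dim_eq_card_independent, simp)
  then show "P \<in> pg_points" using v by (simp add: pg_points_def)
qed

lemma span_singleton_in_pg_points: "v \<noteq> 0 \<Longrightarrow> vec.span {v} \<in> pg_points"
  using pg_points_iff by blast

lemma pg_points_eq: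
  "pg_points = range affine_point \<union> range slope_point \<union> {point_inf}"
proof (intro equalityI subsetI)
  fix P :: "'a pg_point" assume "P \<in> pg_points"
  then obtain v where v: "v \<noteq> 0" "P = vec.span {v}" by (auto simp: pg_points_iff)
  show "P \<in> range affine_point \<union> range slope_point \<union> {point_inf}"
  proof (cases "v $ 3 = 0")
    case False
    have "vec.span {v} = affine_point (v $ 1 / v $ 3, v $ 2 / v $ 3)"
      using False unfolding affine_point_def
      by (subst span_singleton_eq_iff)
        (auto simp: vector3_nonzero vec_eq_iff forall_3 intro!: exI[of _ "v $ 3"])
    then show ?thesis using v by blast
  next
    case v3: True
    show ?thesis
    proof (cases "v $ 1 = 0")
      case False
      have "vec.span {v} = slope_point (v $ 2 / v $ 1)"
        using False v3 unfolding slope_point_def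
        by (subst span_singleton_eq_iff)
          (auto simp: vector3_nonzero vec_eq_iff forall_3 intro!: exI[of _ "v $ 1"])
      then show ?thesis using v by blast
    next
      case True
      then have "v $ 2 \<noteq> 0" using v v3 by (auto simp: vec_eq_iff forall_3)
      then have "vec.span {v} = point_inf"
        using True v3 unfolding point_inf_def
        by (subst span_singleton_eq_iff)
          (auto simp: vector3_nonzero vec_eq_iff forall_3 intro!: exI[of _ "v $ 2"])
      then show ?thesis using v by blast
    qed
  qed
next
  fix P :: "'a pg_point" assume "P \<in> range affine_point \<union> range slope_point \<union> {point_inf}"
  moreover have "affine_point p \<in> pg_points" "slope_point a \<in> pg_points"
    "point_inf \<in> pg_points" for p and a :: 'a
    unfolding affine_point_def slope_point_def point_inf_def
    by (rule span_singleton_in_pg_points, simp add: vector3_nonzero)+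
  ultimately show "P \<in> pg_points" by blast
qed

text \<open>
  A point is contained in a subspace as soon as one representative vector is, so a line can be
  read off from the normalized coordinate vectors in its 2-dimensional subspace.
\<close>

lemma points_in_subspace:
  fixes W :: "('a::field ^ 3) set"
  assumes "vec.subspace W"
  shows "{P \<in> pg_points. P \<subseteq> W} =
    affine_point ` {p. vector [fst p, snd p, 1] \<in> W} \<union> slope_point ` {a. vector [1, a, 0] \<in> W}
      \<union> (if vector [0, 1, 0] \<in> W then {point_inf} else {})"
proof -
  have mem: "affine_point p \<subseteq> W \<longleftrightarrow> vector [fst p, snd p, 1] \<in> W"
    "slope_point a \<subseteq> W \<longleftrightarrow> vector [1, a, 0] \<in> W"
    "point_inf \<subseteq> W \<longleftrightarrow> vector [0, 1, 0] \<in> W" for p and a :: 'a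
    unfolding affine_point_def slope_point_def point_inf_def
    using assms by (simp_all add: span_singleton_subset_iff)
  have "affine_point ` {p. vector [fst p, snd p, 1] \<in> W} = {P \<in> range affine_point. P \<subseteq> W}"
    unfolding mem(1)[symmetric] by blast
  moreover have "slope_point ` {a. vector [1, a, 0] \<in> W} = {P \<in> range slope_point. P \<subseteq> W}"
    unfolding mem(2)[symmetric] by blast
  moreover have "(if vector [0, 1, 0] \<in> W then {point_inf} else {}) = {P \<in> {point_inf}. P \<subseteq> W}"
    unfolding mem(3)[symmetric] by (cases "point_inf \<subseteq> W") auto
  ultimately show ?thesis unfolding pg_points_eq by (simp only:) blast
qed

text \<open>
  Every line is the zero set of one linear form; the three kinds of lines below are obtained
  by specializing its coefficients.
\<close>

lemma subspace_kernel:
  fixes \<alpha> \<beta> \<gamma> :: "'a::field"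
  shows "vec.subspace {v :: 'a ^ 3. \<alpha> * v $ 1 + \<beta> * v $ 2 + \<gamma> * v $ 3 = 0}"
proof (rule vec.subspaceI)
  fix c and x :: "'a ^ 3"
  assume "x \<in> {v. \<alpha> * v $ 1 + \<beta> * v $ 2 + \<gamma> * v $ 3 = 0}"
  then have "c * (\<alpha> * x $ 1 + \<beta> * x $ 2 + \<gamma> * x $ 3) = 0" by simp
  then show "c *s x \<in> {v. \<alpha> * v $ 1 + \<beta> * v $ 2 + \<gamma> * v $ 3 = 0}"
    by (simp add: algebra_simps)
next
  fix x y :: "'a ^ 3"
  assume "x \<in> {v. \<alpha> * v $ 1 + \<beta> * v $ 2 + \<gamma> * v $ 3 = 0}"
    "y \<in> {v. \<alpha> * v $ 1 + \<beta> * v $ 2 + \<gamma> * v $ 3 = 0}"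
  then have "(\<alpha> * x $ 1 + \<beta> * x $ 2 + \<gamma> * x $ 3) + (\<alpha> * y $ 1 + \<beta> * y $ 2 + \<gamma> * y $ 3) = 0"
    by simp
  then show "x + y \<in> {v. \<alpha> * v $ 1 + \<beta> * v $ 2 + \<gamma> * v $ 3 = 0}"
    by (simp add: algebra_simps)
qed simp

lemma subspace_line_inf: "vec.subspace {v :: 'a::field ^ 3. v $ 3 = 0}"
  using subspace_kernel[of 0 0 1] by simp

lemma subspace_vertical_line: "vec.subspace {v :: 'a::field ^ 3. v $ 1 = \<alpha> * v $ 3}"
  using subspace_kernel[of 1 0 "-\<alpha>"] by simp

lemma subspace_graph_line:
  "vec.subspace {v :: 'a::field ^ 3. v $ 2 = a * v $ 1 + b * v $ 3}"
proof -
  have "{v :: 'a ^ 3. v $ 2 = a * v $ 1 + b * v $ 3}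
      = {v. a * v $ 1 + (-1) * v $ 2 + b * v $ 3 = 0}"
    by (auto simp: algebra_simps)
  then show ?thesis using subspace_kernel[of a "-1" b] by simp
qed

lemma dim_two_span:
  fixes W :: "('a::field ^ 'n) set"
  assumes "u \<in> W" "v \<in> W" "u \<noteq> 0" "v \<notin> vec.span {u}" "W \<subseteq> vec.span {u, v}"
  shows "vec.dim W = 2"
proof -
  have ind: "vec.independent {v, u}"
    using assms by (intro vec.independent_insertI) (auto simp: vec.independent_empty)
  have "v \<noteq> u" using assms(4) vec.span_base[of u "{u}"] by auto
  then show ?thesis
    using vec.dim_unique[of "{v, u}" W 2] ind assms by (simp add: insert_commute)
qed

lemma dim_two_eq_span:
  fixes W :: "('a::field ^ 'n) set"
  assumes "vec.subspace W" "vec.dim W = 2" "u \<in> W" "v \<in> W" "u \<noteq> 0" "v \<notin> vec.span {u}"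
  shows "W = vec.span {u, v}"
proof -
  have ind: "vec.independent {v, u}"
    using assms by (intro vec.independent_insertI) (auto simp: vec.independent_empty)
  have "v \<noteq> u" using assms(6) vec.span_base[of u "{u}"] by auto
  then have "card {v, u} = vec.dim W" using assms(2) by simp
  then have "W \<subseteq> vec.span {v, u}"
    using ind assms by (intro vec.card_ge_dim_independent) auto
  moreover have "vec.span {v, u} \<subseteq> W"
    using assms by (intro vec.span_minimal) auto
  ultimately show ?thesis by (simp add: insert_commute)
qed

lemma line_inf_subspace:
  "line_inf = {P \<in> pg_points. P \<subseteq> {v :: 'a::field ^ 3. v $ 3 = 0}}"
  by (auto simp: line_inf_def)

lemma line_inf_eq: "line_inf = insert point_inf (range slope_point)"
  using subspace_line_inf unfolding line_inf_subspace
  by (subst points_in_subspace) auto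

lemma vertical_line_subspace:
  "vertical_line \<alpha> = {P \<in> pg_points. P \<subseteq> {v :: 'a::field ^ 3. v $ 1 = \<alpha> * v $ 3}}"
  using subspace_vertical_line[of \<alpha>] unfolding vertical_line_def
  by (subst points_in_subspace) auto

lemma graph_line_subspace:
  "graph_line a b = {P \<in> pg_points. P \<subseteq> {v :: 'a::field ^ 3. v $ 2 = a * v $ 1 + b * v $ 3}}"
  using subspace_graph_line[of a b] unfolding graph_line_def
  by (subst points_in_subspace) (auto simp: algebra_simps)

lemma in_span_pair:
  fixes u v w :: "'a::field ^ 'n"
  assumes "w = c *s u + d *s v"
  shows "w \<in> vec.span {u, v}"
  unfolding assms by (intro vec.span_add vec.span_scale vec.span_base) auto

lemma line_inf_in_pg_lines: "line_inf \<in> pg_lines"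
proof -
  let ?W = "{v :: 'a ^ 3. v $ 3 = 0}"
  have "vec.subspace ?W" by (rule subspace_line_inf)
  moreover have "vec.dim ?W = 2"
    by (rule dim_two_span[of "vector [0, 1, 0]" _ "vector [1, 0, 0]"])
      (auto simp: vector3_nonzero vec.span_singleton vec_eq_iff forall_3
        intro!: in_span_pair[of _ "_ $ 2" _ "_ $ 1"])
  ultimately show ?thesis unfolding pg_lines_def line_inf_subspace by blast
qed

lemma vertical_line_in_pg_lines: "vertical_line \<alpha> \<in> pg_lines"
proof -
  let ?W = "{v :: 'a ^ 3. v $ 1 = \<alpha> * v $ 3}"
  have "vec.subspace ?W" by (rule subspace_vertical_line)
  moreover have "vec.dim ?W = 2"
    by (rule dim_two_span[of "vector [0, 1, 0]" _ "vector [\<alpha>, 0, 1]"])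
      (auto simp: vector3_nonzero vec.span_singleton vec_eq_iff forall_3
        intro!: in_span_pair[of _ "_ $ 2" _ "_ $ 3"])
  ultimately show ?thesis unfolding pg_lines_def vertical_line_subspace by blast
qed

lemma graph_line_in_pg_lines: "graph_line a b \<in> pg_lines"
proof -
  let ?W = "{v :: 'a ^ 3. v $ 2 = a * v $ 1 + b * v $ 3}"
  have "vec.subspace ?W" by (rule subspace_graph_line)
  moreover have "vec.dim ?W = 2"
    by (rule dim_two_span[of "vector [1, a, 0]" _ "vector [0, b, 1]"])
      (auto simp: vector3_nonzero vec.span_singleton vec_eq_iff forall_3
        intro!: in_span_pair[of _ "_ $ 1" _ "_ $ 3"])
  ultimately show ?thesis unfolding pg_lines_def graph_line_subspace by blast
qed

text \<open>
  The subspace is spanned by \<open>(0, 1, 0)\<close> and one further vector \<open>u\<close>, so its equation restricts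
  only the ratio of the first to the third coordinate: the line is at infinity if \<open>u\<close> has third
  coordinate 0, and otherwise it is the vertical line \<open>x = u\<^sub>1 / u\<^sub>3\<close>.
\<close>

lemma pg_line_through_point_inf:
  fixes W :: "('a::field ^ 3) set"
  assumes W: "vec.subspace W" "vec.dim W = 2" and e2: "vector [0, 1, 0] \<in> W"
  shows "{P \<in> pg_points. P \<subseteq> W} \<in> insert line_inf (range vertical_line)"
proof -
  let ?e = "vector [0, 1, 0] :: 'a ^ 3"
  have e0: "?e \<noteq> 0" by (simp add: vector3_nonzero)
  have "\<not> W \<subseteq> vec.span {?e}"
  proof
    assume "W \<subseteq> vec.span {?e}"
    then have "vec.dim W \<le> card {?e}" by (intro vec.dim_le_card) auto
    then show False using W by simp
  qed
  then obtain u where u: "u \<in> W" "u \<notin> vec.span {?e}" by blast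
  have W_eq: "W = vec.span {w, ?e}" if "w \<in> W" "w $ 1 \<noteq> 0 \<or> w $ 3 \<noteq> 0" for w
  proof -
    have "w \<notin> vec.span {?e}"
      using that by (auto simp: vec.span_singleton)
    then show ?thesis
      using dim_two_eq_span[OF W e2 that(1) e0] by (simp add: insert_commute)
  qed
  have u13: "u $ 1 \<noteq> 0 \<or> u $ 3 \<noteq> 0"
  proof (rule ccontr)
    assume "\<not> (u $ 1 \<noteq> 0 \<or> u $ 3 \<noteq> 0)"
    then have "u = (u $ 2) *s ?e" by (simp add: vec_eq_iff forall_3)
    then show False using u(2) by (metis vec.span_base vec.span_scale singletonI)
  qed
  show ?thesis
  proof (cases "u $ 3 = 0")
    case True
    have "W = {v. v $ 3 = 0}"
    proof (intro equalityI subsetI)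
      fix v assume "v \<in> W"
      then show "v \<in> {v. v $ 3 = 0}"
        using True by (auto simp: W_eq[OF u(1) u13] vec.span_insert vec.span_singleton
            vec_eq_iff forall_3)
    next
      fix v :: "'a ^ 3" assume "v \<in> {v. v $ 3 = 0}"
      then show "v \<in> W" unfolding W_eq[OF u(1) u13]
        using True u13
        by (intro in_span_pair[of _ "v $ 1 / u $ 1" _ "v $ 2 - v $ 1 / u $ 1 * u $ 2"])
          (auto simp: vec_eq_iff forall_3)
    qed
    then have "{P \<in> pg_points. P \<subseteq> W} = line_inf"
      by (simp only: line_inf_subspace)
    then show ?thesis by simp
  next
    case False
    have "W = {v. v $ 1 = u $ 1 / u $ 3 * v $ 3}"
    proof (intro equalityI subsetI)
      fix v assume "v \<in> W"
      then show "v \<in> {v. v $ 1 = u $ 1 / u $ 3 * v $ 3}"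
        using False by (auto simp: W_eq[OF u(1) u13] vec.span_insert vec.span_singleton
            vec_eq_iff forall_3)
    next
      fix v :: "'a ^ 3" assume "v \<in> {v. v $ 1 = u $ 1 / u $ 3 * v $ 3}"
      then show "v \<in> W" unfolding W_eq[OF u(1) u13]
        using False
        by (intro in_span_pair[of _ "v $ 3 / u $ 3" _ "v $ 2 - v $ 3 / u $ 3 * u $ 2"])
          (auto simp: vec_eq_iff forall_3)
    qed
    then have "{P \<in> pg_points. P \<subseteq> W} = vertical_line (u $ 1 / u $ 3)"
      by (simp only: vertical_line_subspace)
    then show ?thesis by simp
  qed
qed

text \<open>
  If \<open>(0, 1, 0)\<close> is not in the plane \<open>W\<close>, it spans a complement of \<open>W\<close>.  Projecting
  \<open>(1, 0, 0)\<close> and \<open>(0, 0, 1)\<close> to \<open>W\<close> along it changes only the second coordinate, and the new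
  second coordinates are the slope and the intercept of the line.
\<close>

lemma pg_line_not_through_point_inf:
  fixes W :: "('a::field ^ 3) set"
  assumes W: "vec.subspace W" "vec.dim W = 2" and e2: "vector [0, 1, 0] \<notin> W"
  shows "\<exists>a b. {P \<in> pg_points. P \<subseteq> W} = graph_line a b"
proof -
  let ?e = "vector [0, 1, 0] :: 'a ^ 3"
  obtain B where B: "B \<subseteq> W" "vec.independent B" "W \<subseteq> vec.span B" "card B = vec.dim W"
    using vec.basis_exists by blast
  have spanB: "vec.span B = W"
    using B W(1) by (simp add: vec.span_subspace)
  have finB: "finite B" using B(2) by (rule vec.finiteI_independent)
  have eB: "?e \<notin> B" using B e2 by auto
  have "vec.independent (insert ?e B)"
    using B(2) e2 spanB by (intro vec.independent_insertI) auto
  moreover have "card (insert ?e B) = 3" using B W finB eB by simp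
  moreover have "vec.dim (UNIV :: ('a ^ 3) set) = 3" by (simp only: vec_dim_card) simp
  ultimately have "UNIV \<subseteq> vec.span (insert ?e B)"
    by (intro vec.card_ge_dim_independent) simp_all
  then have decomp: "\<exists>k. v - k *s ?e \<in> W" for v :: "'a ^ 3"
    using spanB by (auto simp: vec.span_insert)
  obtain k where k: "vector [1, 0, 0] - k *s ?e \<in> W" using decomp by blast
  obtain k' where k': "vector [0, 0, 1] - k' *s ?e \<in> W" using decomp by blast
  define a b where "a = - k" and "b = - k'"
  have a: "vector [1, a, 0] \<in> W"
  proof -
    have "vector [1, a, 0] = vector [1, 0, 0] - k *s ?e"
      by (simp add: a_def vec_eq_iff forall_3)
    then show ?thesis using k by simp
  qed
  have b: "vector [0, b, 1] \<in> W"
  proof -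
    have "vector [0, b, 1] = vector [0, 0, 1] - k' *s ?e"
      by (simp add: b_def vec_eq_iff forall_3)
    then show ?thesis using k' by simp
  qed
  have comb: "v $ 1 *s vector [1, a, 0] + v $ 3 *s vector [0, b, 1] \<in> W" for v :: "'a ^ 3"
    using a b W(1) by (intro vec.subspace_add vec.subspace_scale)
  have "W = {v. v $ 2 = a * v $ 1 + b * v $ 3}"
  proof (intro equalityI subsetI)
    fix v assume v: "v \<in> W"
    \<comment> \<open>Subtracting the expected combination leaves a multiple of \<open>(0, 1, 0)\<close> in \<open>W\<close>.\<close>
    define c where "c = v $ 2 - (a * v $ 1 + b * v $ 3)"
    have "c *s ?e = v - (v $ 1 *s vector [1, a, 0] + v $ 3 *s vector [0, b, 1])"
      by (simp add: c_def vec_eq_iff forall_3 algebra_simps)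
    also have "\<dots> \<in> W" using v comb W(1) by (intro vec.subspace_diff)
    finally have ce: "c *s ?e \<in> W" .
    have "c = 0"
    proof (rule ccontr)
      assume "c \<noteq> 0"
      then have e: "?e = inverse c *s (c *s ?e)" by simp
      have "inverse c *s (c *s ?e) \<in> W" using W(1) ce by (rule vec.subspace_scale)
      then show False using e2 e by metis
    qed
    then show "v \<in> {v. v $ 2 = a * v $ 1 + b * v $ 3}" by (simp add: c_def)
  next
    fix v :: "'a ^ 3" assume "v \<in> {v. v $ 2 = a * v $ 1 + b * v $ 3}"
    then have "v = v $ 1 *s vector [1, a, 0] + v $ 3 *s vector [0, b, 1]"
      by (simp add: vec_eq_iff forall_3 algebra_simps)
    then show "v \<in> W" using comb[of v] by simp
  qed
  then have "{P \<in> pg_points. P \<subseteq> W} = graph_line a b"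
    by (simp only: graph_line_subspace)
  then show ?thesis by blast
qed

text \<open>
  With this classification the points of every line are explicit, and subspaces no longer
  occur in what follows.
\<close>

lemma pg_lines_eq:
  "pg_lines = insert line_inf (range vertical_line \<union> {graph_line a b | a b. True})"
proof (intro equalityI subsetI)
  fix l :: "'a pg_point set" assume "l \<in> pg_lines"
  then obtain W where W: "vec.subspace W" "vec.dim W = 2" "l = {P \<in> pg_points. P \<subseteq> W}"
    by (auto simp: pg_lines_def)
  show "l \<in> insert line_inf (range vertical_line \<union> {graph_line a b | a b. True})"
  proof (cases "vector [0, 1, 0] \<in> W")
    case True
    then show ?thesis using pg_line_through_point_inf[OF W(1,2)] W(3) by auto
  next
    case False
    then obtain a b where "l = graph_line a b"
      using pg_line_not_through_point_inf[OF W(1,2)] W(3) by auto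
    then show ?thesis by simp blast
  qed
qed (auto simp: line_inf_in_pg_lines vertical_line_in_pg_lines graph_line_in_pg_lines)

lemma point_inf_in_line:
  "point_inf \<in> line_inf" "point_inf \<in> vertical_line \<alpha>" "point_inf \<notin> graph_line a b"
  by (auto simp: line_inf_eq vertical_line_def graph_line_def homogeneous_points_distinct)

lemma slope_point_in_line:
  "slope_point a \<in> line_inf" "slope_point a \<notin> vertical_line \<alpha>"
  "slope_point a \<in> graph_line a' b \<longleftrightarrow> a' = a"
  by (auto simp: line_inf_eq vertical_line_def graph_line_def homogeneous_points_distinct)

lemma graph_line_inject: "graph_line a b = graph_line a' b' \<longleftrightarrow> a = a' \<and> b = b'"
proof
  assume eq: "graph_line a b = graph_line a' b'"
  then have "a = a'" using slope_point_in_line(3) by metis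
  moreover have "affine_point (0, b) \<in> graph_line a b"
    by (auto simp: graph_line_def homogeneous_points_distinct)
  then have "b = b'" unfolding eq
    by (auto simp: graph_line_def homogeneous_points_distinct)
  ultimately show "a = a' \<and> b = b'" by simp
qed simp

section \<open>Regularity in terms of intersection numbers\<close>

definition graph_count :: "('a::field \<times> 'a) set \<Rightarrow> 'a \<Rightarrow> 'a \<Rightarrow> nat" where
  "graph_count S a b = card {p \<in> S. snd p = a * fst p + b}"

lemma line_inf_Int_affine: "line_inf \<inter> (affine_point ` S \<union> {point_inf}) = {point_inf}"
proof -
  have "range slope_point \<inter> (affine_point ` S \<union> {point_inf}) = {}"
    by (simp add: disjoint_iff_not_equal ball_Un homogeneous_points_distinct)
  then show ?thesis unfolding line_inf_eq by simp
qed

lemma is_secant_graph_line: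
  fixes S :: "('a::{field,finite} \<times> 'a) set"
  assumes "X = affine_point ` S \<or> X = affine_point ` S \<union> {point_inf}"
  shows "is_secant k X (graph_line a b) \<longleftrightarrow> int (graph_count S a b) = k"
proof -
  have "graph_line a b \<inter> X = affine_point ` {p \<in> S. snd p = a * fst p + b}"
    using assms by (auto simp: graph_line_def homogeneous_points_distinct)
  moreover have "inj_on affine_point {p \<in> S. snd p = a * fst p + b}"
    by (rule inj_onI) (simp only: homogeneous_points_distinct)
  ultimately have "card (graph_line a b \<inter> X) = graph_count S a b"
    unfolding graph_count_def by (simp only: card_image)
  moreover have "finite (graph_line a b \<inter> X)" by (rule finite)
  ultimately show ?thesis
    unfolding is_secant_def using graph_line_in_pg_lines by metis
qed

text \<open>
  The lines through an ideal point other than \<open>(\<infinity>)\<close> are the graphs with that slope together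
  with the line at infinity.  The latter meets the set only in \<open>(\<infinity>)\<close>, so it is
  counted exactly when \<open>m = 1\<close>.
\<close>

lemma card_secants_through_slope_point:
  fixes S :: "('a::{field,finite} \<times> 'a) set"
  assumes "X = affine_point ` S \<union> {point_inf}"
  shows "card {l. is_secant m X l \<and> slope_point a \<in> l}
    = card {b. int (graph_count S a b) = m} + (if m = 1 then 1 else 0)"
proof -
  have inf: "is_secant m X line_inf \<longleftrightarrow> m = 1"
  proof -
    have "line_inf \<inter> X = {point_inf}"
      unfolding assms by (rule line_inf_Int_affine)
    then have "finite (line_inf \<inter> X)" "card (line_inf \<inter> X) = 1"
      by simp_all
    then show ?thesis
      unfolding is_secant_def using line_inf_in_pg_lines by auto
  qed
  have secant: "is_secant m X (graph_line a b) \<longleftrightarrow> int (graph_count S a b) = m" for b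
    using is_secant_graph_line assms by blast
  have "{l. is_secant m X l \<and> slope_point a \<in> l}
      = graph_line a ` {b. int (graph_count S a b) = m} \<union> (if m = 1 then {line_inf} else {})"
    (is "?L = ?R")
  proof (intro equalityI subsetI)
    fix l assume "l \<in> ?L"
    then have l: "is_secant m X l" "slope_point a \<in> l" by simp_all
    then consider "l = line_inf" | \<alpha> where "l = vertical_line \<alpha>"
      | a' b where "l = graph_line a' b"
      unfolding is_secant_def pg_lines_eq by blast
    then show "l \<in> ?R"
    proof cases
      case 1
      then show ?thesis using l inf by simp
    next
      case 2
      then show ?thesis using l slope_point_in_line(2) by metis
    next
      case 3
      then have "a' = a" using l slope_point_in_line(3) by metis
      then have "b \<in> {b. int (graph_count S a b) = m}" "l = graph_line a b"
        using l 3 secant by simp_all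
      then show ?thesis by (simp only: Un_iff image_eqI simp_thms)
    qed
  next
    fix l assume "l \<in> ?R"
    then consider b where "int (graph_count S a b) = m" "l = graph_line a b"
      | "m = 1" "l = line_inf"
      by (cases "m = 1") (simp_all only: if_True if_False Un_iff image_iff, auto)
    then show "l \<in> ?L"
    proof cases
      case 1
      then show ?thesis by (simp add: secant slope_point_in_line)
    next
      case 2
      then show ?thesis using inf by (simp add: slope_point_in_line)
    qed
  qed
  moreover have "card (graph_line a ` A) = card A" for A
    by (rule card_image, rule inj_onI) (simp only: graph_line_inject)
  moreover have "line_inf \<noteq> graph_line a b" for b
    using point_inf_in_line(1,3) by metis
  then have "line_inf \<notin> graph_line a ` A" for A
    by (simp only: image_iff) simp
  ultimately show ?thesis by (cases "m = 1") simp_all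
qed

text \<open>
  Regularity without projective geometry.  The contribution of the line at infinity to the
  number of 1-secants is the same for every ideal point, so it does not affect whether these
  numbers agree.
\<close>

lemma regular_affine_type_iff_graph_count:
  fixes S :: "('a::{field,finite} \<times> 'a) set"
  shows "regular_affine_type point_inf line_inf ms (affine_point ` S \<union> {point_inf}) \<longleftrightarrow>
    (\<forall>a b. int (graph_count S a b) \<in> set ms) \<and>
    (\<forall>m\<in>set ms. \<exists>c. \<forall>a. card {b. int (graph_count S a b) = m} = c)"
proof -
  let ?X = "affine_point ` S \<union> {point_inf}"
  have "?X \<subseteq> pg_points" unfolding pg_points_eq by blast
  moreover have "point_inf \<in> ?X" by simp
  moreover have "(line_inf :: 'a pg_point set) \<in> pg_lines" by (rule line_inf_in_pg_lines)
  moreover note line_inf_Int_affine[of S]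
  moreover have "(\<forall>l\<in>pg_lines. point_inf \<notin> l \<longrightarrow> (\<exists>m\<in>set ms. is_secant m ?X l)) \<longleftrightarrow>
      (\<forall>a b. int (graph_count S a b) \<in> set ms)"
  proof -
    have "(\<forall>l\<in>pg_lines. point_inf \<notin> l \<longrightarrow> Q l) \<longleftrightarrow> (\<forall>a b. Q (graph_line a b))"
      for Q :: "'a pg_point set \<Rightarrow> bool"
      unfolding pg_lines_eq using point_inf_in_line by (simp only: ball_simps) fast
    moreover have "is_secant m ?X (graph_line a b) \<longleftrightarrow> int (graph_count S a b) = m" for m a b
      using is_secant_graph_line by blast
    ultimately show ?thesis by simp
  qed
  moreover have "(\<exists>c. \<forall>P\<in>line_inf - {point_inf}. card {l. is_secant m ?X l \<and> P \<in> l} = c) \<longleftrightarrow>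
      (\<exists>c. \<forall>a. card {b. int (graph_count S a b) = m} = c)" for m
  proof -
    have "line_inf - {point_inf :: 'a pg_point} = range slope_point"
    proof -
      have "(point_inf :: 'a pg_point) \<notin> range slope_point"
        by (simp add: image_iff homogeneous_points_distinct)
      then show ?thesis unfolding line_inf_eq by simp
    qed
    then have "(\<exists>c. \<forall>P\<in>line_inf - {point_inf}. card {l. is_secant m ?X l \<and> P \<in> l} = c) \<longleftrightarrow>
        (\<exists>c. \<forall>a. card {b. int (graph_count S a b) = m} + (if m = 1 then 1 else 0) = c)"
      using card_secants_through_slope_point[of ?X S m] by simp
    also have "\<dots> \<longleftrightarrow> (\<exists>c. \<forall>a. card {b. int (graph_count S a b) = m} = c)"
      by (metis add_right_cancel)
    finally show ?thesis .
  qed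
  ultimately show ?thesis unfolding regular_affine_type_def by simp
qed

lemma card_nonvertical_secants:
  fixes S :: "('a::{field,finite} \<times> 'a) set"
  shows "card {l \<in> affine_lines. l \<notin> range vertical_line \<and> is_secant k (affine_point ` S) l}
    = (\<Sum>a\<in>UNIV. card {b. int (graph_count S a b) = k})"
proof -
  have secant: "is_secant k (affine_point ` S) (graph_line a b) \<longleftrightarrow>
      int (graph_count S a b) = k" for a b
    using is_secant_graph_line by blast
  have "{l \<in> affine_lines. l \<notin> range vertical_line \<and> is_secant k (affine_point ` S) l}
      = (\<lambda>(a, b). graph_line a b) ` (SIGMA a:UNIV. {b. int (graph_count S a b) = k})"
    (is "?L = ?R")
  proof (intro equalityI subsetI)
    fix l assume "l \<in> ?L"
    then have l: "l \<in> pg_lines" "l \<noteq> line_inf" "l \<notin> range vertical_line"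
      "is_secant k (affine_point ` S) l"
      by (simp_all add: affine_lines_def)
    then obtain a b where ab: "l = graph_line a b"
      unfolding pg_lines_eq by blast
    then have "int (graph_count S a b) = k" using l(4) secant by simp
    then show "l \<in> ?R" using ab by (intro image_eqI[of _ _ "(a, b)"]) simp_all
  next
    fix l assume "l \<in> ?R"
    then obtain a b where ab: "l = graph_line a b" "int (graph_count S a b) = k"
      by auto
    have "graph_line a b \<noteq> line_inf" "graph_line a b \<noteq> vertical_line \<alpha>" for \<alpha>
      using point_inf_in_line by metis+
    then show "l \<in> ?L"
      using ab secant graph_line_in_pg_lines[of a b]
      by (simp add: affine_lines_def image_iff)
  qed
  moreover have "inj_on (\<lambda>(a, b). graph_line a b) A" for A :: "('a \<times> 'a) set"
    by (auto simp: inj_on_def graph_line_inject)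
  ultimately show ?thesis by (simp add: card_image)
qed

section \<open>Splitting the larger field as a direct sum\<close>

text \<open>
  Adjoining a basis vector \<open>b\<close> multiplies the number of elements by the order of the field of
  scalars, because \<open>(c, v) \<mapsto> c b + v\<close> is injective when \<open>b\<close> is outside the span.
\<close>

lemma card_span_independent:
  fixes scale :: "'a::{field,finite} \<Rightarrow> 'b::ab_group_add \<Rightarrow> 'b"
  assumes "vector_space scale" and "finite B" and "\<not> module.dependent scale B"
  shows "card (module.span scale B) = CARD('a) ^ card B"
proof -
  interpret vector_space scale by fact
  show ?thesis using assms(2,3)
  proof (induction B rule: finite_induct)
    case empty
    then show ?case by simp
  next
    case (insert b B)
    have ind: "independent B" "b \<notin> span B"
      using insert.prems insert.hyps by (auto simp: independent_insert)
    let ?f = "\<lambda>(c, v). scale c b + v"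
    have inj: "inj_on ?f (UNIV \<times> span B)"
    proof (clarsimp simp: inj_on_def)
      fix c v d w assume vw: "v \<in> span B" "w \<in> span B" and eq: "scale c b + v = scale d b + w"
      have "scale (c - d) b = w - v"
        using eq by (simp add: scale_left_diff_distrib algebra_simps)
      then have in_span: "scale (c - d) b \<in> span B"
        using vw by (simp add: span_diff)
      have "c = d"
      proof (rule ccontr)
        assume "c \<noteq> d"
        then have "b = scale (inverse (c - d)) (scale (c - d) b)" by simp
        then show False using ind(2) in_span span_scale by metis
      qed
      then show "c = d \<and> v = w" using eq by simp
    qed
    have "span (insert b B) = ?f ` (UNIV \<times> span B)"
    proof (intro equalityI subsetI)
      fix x assume "x \<in> span (insert b B)"
      then obtain c where "x - scale c b \<in> span B" by (auto simp: span_insert)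
      then show "x \<in> ?f ` (UNIV \<times> span B)"
        by (intro image_eqI[of _ _ "(c, x - scale c b)"]) auto
    next
      fix x assume "x \<in> ?f ` (UNIV \<times> span B)"
      then obtain c v where "x = scale c b + v" "v \<in> span B" by auto
      then have "x - scale c b \<in> span B" by simp
      then show "x \<in> span (insert b B)" unfolding span_insert by blast
    qed
    then have "card (span (insert b B)) = CARD('a) * card (span B)"
      using inj by (simp add: card_image card_cartesian_product)
    then show ?case using insert ind by simp
  qed
qed

lemma card_subspace:
  fixes scale :: "'a::{field,finite} \<Rightarrow> 'b::{ab_group_add,finite} \<Rightarrow> 'b"
  assumes "vector_space scale" and "module.subspace scale V"
  shows "card V = CARD('a) ^ vector_space.dim scale V"
proof -
  interpret vector_space scale by fact
  obtain B where B: "B \<subseteq> V" "independent B" "V \<subseteq> span B" "card B = dim V"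
    using basis_exists by blast
  then have "span B = V" using assms(2) by (simp add: span_subspace)
  then show ?thesis using card_span_independent[OF assms(1), of B] B by simp
qed

text \<open>
  Trivial intersection makes the sum direct; it is everything because the cardinalities
  agree.
\<close>

lemma direct_sum_bij:
  fixes \<iota> :: "'a::{field,finite} \<Rightarrow> 'b::{field,finite}"
  assumes emb: "field_embedding \<iota>" and I: "subspace_over \<iota> I" "I \<inter> range \<iota> = {0}"
    and card: "CARD('b) = CARD('a) * card I"
  shows "bij_betw (\<lambda>(a, i). \<iota> a + i) (UNIV \<times> I) UNIV"
proof -
  interpret vector_space "\<lambda>c v. \<iota> c * v" by (rule vector_space_over[OF emb])
  have inj: "inj_on (\<lambda>(a, i). \<iota> a + i) (UNIV \<times> I)"
  proof (clarsimp simp: inj_on_def)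
    fix a i a' i' assume i: "i \<in> I" "i' \<in> I" and eq: "\<iota> a + i = \<iota> a' + i'"
    have add: "\<iota> (x + y) = \<iota> x + \<iota> y" for x y
      using emb by (simp add: field_embedding_def)
    have diff: "\<iota> (a - a') = i' - i"
      using add[of "a - a'" a'] eq by (simp add: algebra_simps)
    then have "\<iota> (a - a') \<in> I"
      using i subspace_diff[OF I(1)] by simp
    then have 0: "\<iota> (a - a') = 0" using I(2) by blast
    have "a - a' = 0"
    proof (rule ccontr)
      assume "a - a' \<noteq> 0"
      then have "\<iota> ((a - a') * inverse (a - a')) = 1"
        using emb by (simp add: field_embedding_def)
      then show False using emb 0 by (simp add: field_embedding_def)
    qed
    then show "a = a' \<and> i = i'" using eq by simp
  qed
  moreover have "card ((\<lambda>(a, i). \<iota> a + i) ` (UNIV \<times> I)) = CARD('b)"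
    using inj card by (simp add: card_image card_cartesian_product)
  then have "(\<lambda>(a, i). \<iota> a + i) ` (UNIV \<times> I) = UNIV"
    by (intro card_subset_eq) auto
  ultimately show ?thesis by (simp add: bij_betw_def)
qed

section \<open>Intersection numbers of the lifted set\<close>

definition lift_set :: "('a \<Rightarrow> 'b::field) \<Rightarrow> 'b set \<Rightarrow> ('a \<times> 'a) set \<Rightarrow> ('b \<times> 'b) set" where
  "lift_set \<iota> I S = {(\<iota> x, \<iota> y + i) | x y i. i \<in> I \<and> (x, y) \<in> S}"

text \<open>
  The heart of the proof.  The projection of \<open>F \<oplus> I\<close> to \<open>F\<close>, applied to both coefficients,
  preserves intersection numbers: the shift \<open>k \<in> I\<close> of a point over \<open>(x, y) \<in> S\<close> on the line
  must be \<open>i x + j\<close>, and this element does lie in \<open>I\<close> because \<open>x\<close> is a scalar.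
\<close>

lemma graph_count_lift_set:
  fixes \<iota> :: "'a::field \<Rightarrow> 'b::field"
  assumes emb: "field_embedding \<iota>" and I: "subspace_over \<iota> I"
    and inj: "inj_on (\<lambda>(a, i). \<iota> a + i) (UNIV \<times> I)"
    and ij: "i \<in> I" "j \<in> I"
  shows "graph_count (lift_set \<iota> I S) (\<iota> a + i) (\<iota> b + j) = graph_count S a b"
proof -
  interpret vector_space "\<lambda>c v. \<iota> c * v" by (rule vector_space_over[OF emb])
  have hom: "\<iota> (x + y) = \<iota> x + \<iota> y" "\<iota> (x * y) = \<iota> x * \<iota> y" for x y
    using emb by (simp_all add: field_embedding_def)
  have in_I: "\<iota> x * i + j \<in> I" for x
    using ij by (intro subspace_add[OF I] subspace_scale[OF I])
  have unique: "a = a' \<and> k = k'" if "\<iota> a + k = \<iota> a' + k'" "k \<in> I" "k' \<in> I" for a a' k k'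
    using inj_onD[OF inj, of "(a, k)" "(a', k')"] that by simp
  let ?f = "\<lambda>p. (\<iota> (fst p), \<iota> (snd p) + (\<iota> (fst p) * i + j))"
  have line: "\<iota> y + k = (\<iota> a + i) * \<iota> x + (\<iota> b + j) \<longleftrightarrow>
      y = a * x + b \<and> k = \<iota> x * i + j" if "k \<in> I" for x y k
  proof -
    have "(\<iota> a + i) * \<iota> x + (\<iota> b + j) = \<iota> (a * x + b) + (\<iota> x * i + j)"
      by (simp add: hom algebra_simps)
    then show ?thesis using unique[of y k "a * x + b" "\<iota> x * i + j"] that in_I by metis
  qed
  have "{p \<in> lift_set \<iota> I S. snd p = (\<iota> a + i) * fst p + (\<iota> b + j)}
      = ?f ` {p \<in> S. snd p = a * fst p + b}" (is "?L = ?R")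
  proof (intro equalityI subsetI)
    fix p assume p: "p \<in> ?L"
    then obtain x y k where xyk: "p = (\<iota> x, \<iota> y + k)" "k \<in> I" "(x, y) \<in> S"
      by (auto simp: lift_set_def)
    then have "y = a * x + b" "k = \<iota> x * i + j" using p line by auto
    then show "p \<in> ?R" using xyk by (intro image_eqI[of _ _ "(x, y)"]) auto
  next
    fix p assume "p \<in> ?R"
    then obtain x y where xy: "(x, y) \<in> S" "y = a * x + b"
      "p = (\<iota> x, \<iota> y + (\<iota> x * i + j))" by auto
    then have "p \<in> lift_set \<iota> I S" unfolding lift_set_def using in_I by blast
    then show "p \<in> ?L" using xy line[OF in_I, of y x] by simp
  qed
  moreover have "inj_on ?f {p \<in> S. snd p = a * fst p + b}"
  proof (rule inj_onI)
    fix p p' assume p: "p \<in> {p \<in> S. snd p = a * fst p + b}"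
      "p' \<in> {p \<in> S. snd p = a * fst p + b}" "?f p = ?f p'"
    have "fst p = fst p'"
      using unique[of "fst p" 0 "fst p'" 0] p(3) subspace_0[OF I] by simp
    then show "p = p'" using p(1,2) by (simp add: prod_eq_iff)
  qed
  ultimately show ?thesis unfolding graph_count_def by (simp only: card_image)
qed

text \<open>
  Each intercept \<open>b\<close> over the small field is the projection of the \<open>|I|\<close> intercepts \<open>b + j\<close>.
\<close>

lemma card_intercepts_lift_set:
  fixes \<iota> :: "'a::field \<Rightarrow> 'b::field"
  assumes emb: "field_embedding \<iota>" and I: "subspace_over \<iota> I"
    and bij: "bij_betw (\<lambda>(a, i). \<iota> a + i) (UNIV \<times> I) UNIV"
    and i: "i \<in> I"
  shows "card {B. int (graph_count (lift_set \<iota> I S) (\<iota> a + i) B) = m}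
    = card I * card {b. int (graph_count S a b) = m}"
proof -
  let ?f = "\<lambda>(b, j). \<iota> b + j"
  have inj: "inj_on ?f (UNIV \<times> I)" and surj: "?f ` (UNIV \<times> I) = UNIV"
    using bij by (auto simp: bij_betw_def)
  have count: "graph_count (lift_set \<iota> I S) (\<iota> a + i) (\<iota> b + j) = graph_count S a b"
    if "j \<in> I" for b j
    using graph_count_lift_set[OF emb I inj i that] .
  have "{B. int (graph_count (lift_set \<iota> I S) (\<iota> a + i) B) = m}
      = ?f ` ({b. int (graph_count S a b) = m} \<times> I)" (is "?L = ?R")
  proof (intro equalityI subsetI)
    fix B assume B: "B \<in> ?L"
    have "B \<in> ?f ` (UNIV \<times> I)" using surj by simp
    then obtain b j where "B = \<iota> b + j" "j \<in> I" by auto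
    then show "B \<in> ?R" using B count by (intro image_eqI[of _ _ "(b, j)"]) auto
  qed (auto simp: count)
  moreover have "inj_on ?f ({b. int (graph_count S a b) = m} \<times> I)"
    using inj by (rule inj_on_subset) auto
  ultimately show ?thesis by (simp add: card_image card_cartesian_product)
qed

theorem theorem2p3:
  fixes \<iota> :: "'a::{field,finite} \<Rightarrow> 'b::{field,finite}"
    and q h :: nat
    and S :: "('a \<times> 'a) set"
    and S' :: "('b \<times> 'b) set"
    and I :: "'b set"
    and ms :: "int list"
  assumes "primepow q" and "h \<ge> 2"
    and "CARD('a) = q" and "CARD('b) = q ^ h"
    and "field_embedding \<iota>"
    and "regular_affine_type point_inf line_inf ms (affine_point ` S \<union> {point_inf})"
    and "subspace_over \<iota> I" and "dim_over \<iota> I = h - 1"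
    and "I \<inter> range \<iota> = {0}"
    and "S' = {(\<iota> x, \<iota> y + i) | x y i. i \<in> I \<and> (x, y) \<in> S}"
  shows "regular_affine_type point_inf line_inf ms (affine_point ` S' \<union> {point_inf})
    \<and> (\<forall>k::int. q ^ (2 * h - 1) dvd
         card {l \<in> affine_lines. l \<notin> range vertical_line \<and> is_secant k (affine_point ` S') l})"
proof -
  have S': "S' = lift_set \<iota> I S" using assms(10) by (simp add: lift_set_def)
  have card_I: "card I = q ^ (h - 1)"
    using card_subspace[OF vector_space_over[OF assms(5)] assms(7)] assms(3,8) by simp
  have "CARD('b) = CARD('a) * card I"
    using assms(2,3,4) card_I by (cases h) auto
  then have bij: "bij_betw (\<lambda>(a, i). \<iota> a + i) (UNIV \<times> I) UNIV"
    by (rule direct_sum_bij[OF assms(5,7,9)])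
  have decomp: "\<exists>a i. A = \<iota> a + i \<and> i \<in> I" for A
  proof -
    have "A \<in> (\<lambda>(a, i). \<iota> a + i) ` (UNIV \<times> I)" using bij by (simp add: bij_betw_def)
    then show ?thesis by auto
  qed
  have member: "int (graph_count S a b) \<in> set ms" for a b
    using assms(6) unfolding regular_affine_type_iff_graph_count by blast
  have const: "\<exists>c. \<forall>a. card {b. int (graph_count S a b) = m} = c" if "m \<in> set ms" for m
    using assms(6) that unfolding regular_affine_type_iff_graph_count by blast
  have member': "int (graph_count S' A B) \<in> set ms" for A B
  proof -
    obtain a i b j where "A = \<iota> a + i" "i \<in> I" "B = \<iota> b + j" "j \<in> I"
      using decomp by metis
    then show ?thesis
      using graph_count_lift_set[OF assms(5,7) bij_betw_imp_inj_on[OF bij]] member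
      by (simp add: S')
  qed
  \<comment> \<open>Also for \<open>k\<close> outside the type, where the number of intercepts is 0.\<close>
  have const': "\<exists>c. \<forall>A. card {B. int (graph_count S' A B) = k} = q ^ (h - 1) * c" for k
  proof (cases "k \<in> set ms")
    case True
    then obtain c where c: "\<And>a. card {b. int (graph_count S a b) = k} = c"
      using const by blast
    have "card {B. int (graph_count S' A B) = k} = q ^ (h - 1) * c" for A
      using decomp[of A] card_intercepts_lift_set[OF assms(5,7) bij] c
      by (auto simp: S' card_I)
    then show ?thesis by blast
  next
    case False
    then have "{B. int (graph_count S' A B) = k} = {}" for A using member' by blast
    then have "card {B. int (graph_count S' A B) = k} = q ^ (h - 1) * 0" for A by simp
    then show ?thesis by blast
  qed
  have "regular_affine_type point_inf line_inf ms (affine_point ` S' \<union> {point_inf})"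
    unfolding regular_affine_type_iff_graph_count using member' const' by blast
  moreover have "q ^ (2 * h - 1) dvd
      card {l \<in> affine_lines. l \<notin> range vertical_line \<and> is_secant k (affine_point ` S') l}" for k
  proof -
    obtain c where c: "\<And>A. card {B. int (graph_count S' A B) = k} = q ^ (h - 1) * c"
      using const' by blast
    have "2 * h - 1 = h + (h - 1)" using assms(2) by simp
    then have "q ^ (2 * h - 1) = q ^ h * q ^ (h - 1)" by (simp add: power_add)
    moreover have "card {l \<in> affine_lines. l \<notin> range vertical_line \<and>
        is_secant k (affine_point ` S') l} = q ^ h * (q ^ (h - 1) * c)"
      by (simp add: card_nonvertical_secants c assms(4))
    ultimately show ?thesis by simp
  qed
  ultimately show ?thesis by blast
qed

end
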